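(* Let $T_k \sim \text{NegOcc}(m,k,\theta)$ with $0<k\leq m$ and $0<\theta\leq 1$, and let $\mu_{m,k,\theta}$ and $\sigma^2_{m,k,\theta}$ denote its mean and variance. If $m \to \infty$ and $k \to \infty$ with $k/m \to \lambda$ then we have the following asymptotically equivalent forms for the mean and variance of the distribution: $$\mu_{m,k,\theta} \sim \mu^*_{m,k,\theta} = -k - \frac{m}{\theta}\cdot\ln\left(\frac{m-k}{m}\right),$$ $$\sigma^2_{m,k,\theta} \sim \sigma^{*2}_{m,k,\theta} = \frac{m}{\theta^2}\cdot\frac{k}{m-k} + \frac{m}{\theta}\cdot\ln\left(\frac{m-k}{m}\right).$$ All higher order cumulants are of the form $\kappa^*_r = m\cdot f(\lambda,\theta)$ (for each order $r$, with $f$ a function of $\lambda$ and $\theta$), which means that all the higher order cumulants of $T_k/m$ are of order $O(m^{-1})$, so they vanish in the limit.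
   Context: Falling factorials: $(m)_k = \prod_{i=0}^{k-1}(m-i)$. The noncentral Stirling numbers of the second kind are, for integers $n, k \geq 0$ and real $\phi$, $$S(n,k,\phi) = \frac{1}{k!}\sum_{i=0}^{k} \binom{k}{i} (-1)^{k-i} (i+\phi)^n, \qquad 0^0 = 1.$$ The negative occupancy distribution $\text{NegOcc}(m,k,\theta)$ is the distribution on the integers $t \geq 0$ with probability mass function $$\text{NegOcc}(t|m,k,\theta) = \frac{\theta^{k+t}}{m^{k+t}} \cdot (m)_k \cdot S\left(k+t-1, k-1, m\cdot\frac{1-\theta}{\theta}\right).$$ The $r$th cumulant of a random variable $X$ is the $r$th derivative at $s=0$ of its cumulant function $\ln\mathbb{E}(e^{sX})$. The asymptotic cumulants $\kappa^*_r$ are the $r$th derivatives at $s=0$ of the asymptotic form of the cumulant function of $T_k$ in the stated limit, namely $$m\left[\lambda\ln(\theta) - (1-\lambda)\ln|1-\lambda| - \frac{1-(1-\theta)e^s}{\theta e^s}\ln|1-(1-\theta)e^s| + \frac{1-(1-\theta)e^s-\lambda\theta e^s}{\theta e^s}\ln|1-(1-\theta)e^s-\lambda\theta e^s|\right].$$ The notation $a\sim b$ denotes asymptotic equivalence ($a/b\to 1$) in the stated limit.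
   Formalization: The limit λ of k/m is assumed to be less than 1: at λ = 1 the asymptotic cumulants are undefined, and the variance equivalence fails, e.g. for m − k = 1 (ratio tends to π²/6 − 1). *)

theory Defs
  imports "HOL-Probability.Probability" "HOL-Library.Landau_Symbols"
begin

definition falling_fact :: "real \<Rightarrow> nat \<Rightarrow> real" where
  "falling_fact x k = (\<Prod>i<k. x - real i)"

definition noncentral_stirling2 :: "nat \<Rightarrow> nat \<Rightarrow> real \<Rightarrow> real" where
  "noncentral_stirling2 n k \<phi> =
     1 / fact k * (\<Sum>i\<le>k. real (k choose i) * (-1) ^ (k - i) * (real i + \<phi>) ^ n)"

(* Only used for k > 0, so the subtractions on nat do not truncate. *)
definition neg_occ :: "nat \<Rightarrow> nat \<Rightarrow> real \<Rightarrow> nat \<Rightarrow> real" where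
  "neg_occ m k \<theta> t =
     \<theta> ^ (k + t) / real m ^ (k + t) * falling_fact (real m) k *
     noncentral_stirling2 (k + t - 1) (k - 1) (real m * ((1 - \<theta>) / \<theta>))"

definition cumulant_function :: "'a measure \<Rightarrow> ('a \<Rightarrow> real) \<Rightarrow> real \<Rightarrow> real" where
  "cumulant_function M X s = ln (\<integral>\<omega>. exp (s * X \<omega>) \<partial>M)"

definition cumulant :: "nat \<Rightarrow> 'a measure \<Rightarrow> ('a \<Rightarrow> real) \<Rightarrow> real" where
  "cumulant r M X = (deriv ^^ r) (cumulant_function M X) 0"

definition asymp_mean :: "nat \<Rightarrow> nat \<Rightarrow> real \<Rightarrow> real" where
  "asymp_mean m k \<theta> =
     - real k - real m / \<theta> * ln ((real m - real k) / real m)"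

definition asymp_variance :: "nat \<Rightarrow> nat \<Rightarrow> real \<Rightarrow> real" where
  "asymp_variance m k \<theta> =
     real m / \<theta>\<^sup>2 * (real k / (real m - real k)) +
     real m / \<theta> * ln ((real m - real k) / real m)"

(* l is the limit of k/m. *)
definition asymp_cumulant_function :: "nat \<Rightarrow> real \<Rightarrow> real \<Rightarrow> real \<Rightarrow> real" where
  "asymp_cumulant_function m l \<theta> s =
     real m *
       (l * ln \<theta> - (1 - l) * ln \<bar>1 - l\<bar>
        - (1 - (1 - \<theta>) * exp s) / (\<theta> * exp s) * ln \<bar>1 - (1 - \<theta>) * exp s\<bar>
        + (1 - (1 - \<theta>) * exp s - l * \<theta> * exp s) / (\<theta> * exp s) *
            ln \<bar>1 - (1 - \<theta>) * exp s - l * \<theta> * exp s\<bar>)"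

definition asymp_cumulant :: "nat \<Rightarrow> nat \<Rightarrow> real \<Rightarrow> real \<Rightarrow> real" where
  "asymp_cumulant r m l \<theta> = (deriv ^^ r) (asymp_cumulant_function m l \<theta>) 0"

end

theory Submission
  imports Defs "HOL-Computational_Algebra.Polynomial"
begin

text \<open>By the recurrence of the noncentral Stirling numbers, the probability generating function of
  \<open>T\<^sub>k\<close> is \<open>\<Prod>i<k. p\<^sub>i / (1 - (1 - p\<^sub>i) z)\<close> with \<open>p\<^sub>i = \<theta> (1 - i/m)\<close>, so every cumulant is a
  Riemann sum \<open>\<Sum>i<k. g\<^sub>r(i/m)\<close>, where \<open>g\<^sub>r(x)\<close> is the \<open>r\<close>th cumulant of a geometric variable with
  success probability \<open>\<theta> (1 - x)\<close>. The asymptotic forms are the corresponding integrals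
  \<open>m \<integral> g\<^sub>r\<close> over \<open>[0, k/m]\<close> or \<open>[0, \<lambda>]\<close>, and the error of the Riemann sum is \<open>O(k/m)\<close>. For the
  mean and the variance the integral is at least \<open>k\<^sup>2 / (2m)\<close> since \<open>g\<^sub>r(x) \<ge> x\<close>, so the relative error
  is \<open>O(1/k)\<close>; this also covers the degenerate case \<open>\<lambda> = 0\<close>, \<open>\<theta> = 1\<close>.\<close>

section \<open>Noncentral Stirling numbers\<close>

lemma noncentral_stirling2_0_right [simp]: "noncentral_stirling2 n 0 \<phi> = \<phi> ^ n"
  by (simp add: noncentral_stirling2_def)

text \<open>With \<open>n = 0\<close> every power equals 1 (also \<open>0 ^ 0\<close>), so the sum
  is the binomial expansion of \<open>(1 + (-1)) ^ Suc k\<close>.\<close>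

lemma noncentral_stirling2_0_Suc [simp]: "noncentral_stirling2 0 (Suc k) \<phi> = 0"
proof -
  have "(\<Sum>i\<le>Suc k. real (Suc k choose i) * (- 1) ^ (Suc k - i)) = (1 + (-1)) ^ Suc k"
    by (subst binomial_ring) simp
  then show ?thesis
    unfolding noncentral_stirling2_def by (simp del: sum.atMost_Suc)
qed

text \<open>One factor \<open>i + \<phi>\<close> is split as
  \<open>(k + 1 + \<phi>) - (k + 1 - i)\<close>. The first part gives the multiple of the same
  column; in the second, \<open>k + 1 - i\<close> is absorbed into the binomial coefficient, which
  leaves the sum for column \<open>k\<close>.\<close>

lemma noncentral_stirling2_Suc_Suc:
  "noncentral_stirling2 (Suc n) (Suc k) \<phi> =
     noncentral_stirling2 n k \<phi> + (real (Suc k) + \<phi>) * noncentral_stirling2 n (Suc k) \<phi>"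
proof -
  define c where "c i = real (Suc k choose i) * (-1) ^ (Suc k - i) * (real i + \<phi>) ^ n" for i
  \<comment> \<open>The minus sign arises because the exponent of \<open>-1\<close> drops from
    \<open>Suc k - i\<close> to \<open>k - i\<close>.\<close>
  have absorb: "c i * real (Suc k - i) =
      - (real (Suc k) * (real (k choose i) * (-1) ^ (k - i) * (real i + \<phi>) ^ n))"
    if "i \<le> k" for i
  proof -
    have "real (Suc k choose i) * real (Suc k - i) = real (Suc k) * real (k choose i)"
      using binomial_absorb_comp[of "Suc k" i] by (metis diff_Suc_1 mult.commute of_nat_mult)
    then show ?thesis
      using that by (simp add: c_def Suc_diff_le mult_ac del: binomial_Suc_Suc of_nat_Suc)
  qed
  have "(\<Sum>i\<le>Suc k. real (Suc k choose i) * (-1) ^ (Suc k - i) * (real i + \<phi>) ^ Suc n)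
      = (\<Sum>i\<le>Suc k. (real (Suc k) + \<phi>) * c i - c i * real (Suc k - i))"
    by (intro sum.cong refl) (simp add: c_def of_nat_diff algebra_simps del: binomial_Suc_Suc)
  also have "\<dots> = (real (Suc k) + \<phi>) * sum c {..Suc k} - (\<Sum>i\<le>k. c i * real (Suc k - i))"
    by (simp add: sum_subtractf sum_distrib_left distrib_left)
  also have "(\<Sum>i\<le>k. c i * real (Suc k - i)) =
      - (real (Suc k) * (\<Sum>i\<le>k. real (k choose i) * (-1) ^ (k - i) * (real i + \<phi>) ^ n))"
    unfolding sum_distrib_left sum_negf [symmetric] by (intro sum.cong refl absorb) simp
  finally have rec: "(\<Sum>i\<le>Suc k. real (Suc k choose i) * (-1) ^ (Suc k - i) * (real i + \<phi>) ^ Suc n) =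
      (real (Suc k) + \<phi>) * sum c {..Suc k} +
      real (Suc k) * (\<Sum>i\<le>k. real (k choose i) * (-1) ^ (k - i) * (real i + \<phi>) ^ n)"
    by simp
  have "1 / (c * d) * (a * x + c * y) = 1 / d * y + a * (1 / (c * d) * x)"
    if "c \<noteq> 0" "d \<noteq> 0" for a c d x y :: real
    using that by (simp add: field_simps)
  from this[of "real (Suc k)" "fact k"]
  have "1 / fact (Suc k) * (a * x + real (Suc k) * y) =
      1 / fact k * y + a * (1 / fact (Suc k) * x)" for a x y :: real
    by (simp only: fact_Suc of_nat_fact) simp
  then show ?thesis
    unfolding noncentral_stirling2_def rec c_def by blast
qed

lemma noncentral_stirling2_less: "n < k \<Longrightarrow> noncentral_stirling2 n k \<phi> = 0"
proof (induction n arbitrary: k)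
  case 0
  then show ?case by (cases k) auto
next
  case (Suc n)
  then show ?case by (cases k) (auto simp: noncentral_stirling2_Suc_Suc)
qed

lemma noncentral_stirling2_same [simp]: "noncentral_stirling2 k k \<phi> = 1"
  by (induction k) (auto simp: noncentral_stirling2_Suc_Suc noncentral_stirling2_less)

text \<open>The defining sum alternates in sign; the recurrence has only nonnegative
  coefficients.\<close>

lemma noncentral_stirling2_nonneg:
  assumes "0 \<le> \<phi>"
  shows "0 \<le> noncentral_stirling2 n k \<phi>"
proof (induction n arbitrary: k)
  case 0
  then show ?case by (cases k) auto
next
  case (Suc n)
  then show ?case using assms by (cases k) (auto simp: noncentral_stirling2_Suc_Suc)
qed

text \<open>The recurrence unrolled along column \<open>Suc k\<close>: it is the convolution of
  column \<open>k\<close> with a geometric sequence, so each column multiplies the generating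
  function by one geometric factor.\<close>

lemma noncentral_stirling2_conv_sum:
  "noncentral_stirling2 (Suc k + t) (Suc k) \<phi> =
     (\<Sum>j\<le>t. (real (Suc k) + \<phi>) ^ j * noncentral_stirling2 (k + (t - j)) k \<phi>)"
proof (induction t)
  case 0
  then show ?case by simp
next
  case (Suc t)
  have "noncentral_stirling2 (Suc k + Suc t) (Suc k) \<phi> =
      noncentral_stirling2 (k + Suc t) k \<phi> +
      (real (Suc k) + \<phi>) * noncentral_stirling2 (Suc k + t) (Suc k) \<phi>"
    using noncentral_stirling2_Suc_Suc[of "k + Suc t" k \<phi>] by simp
  then show ?case
    unfolding Suc by (simp add: sum.atMost_Suc_shift sum_distrib_left mult_ac del: of_nat_Suc sum.atMost_Suc)
qed

text \<open>Induction on \<open>k\<close> by a Cauchy product with a geometric series. Nonnegativity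
  of the terms turns convergence into the absolute convergence that the product requires.\<close>

lemma noncentral_stirling2_gf:
  assumes "0 \<le> \<phi>" "0 \<le> x" "(real k + \<phi>) * x < 1"
  shows "(\<lambda>t. noncentral_stirling2 (k + t) k \<phi> * x ^ t) sums (\<Prod>j\<le>k. 1 / (1 - (real j + \<phi>) * x))"
  using assms(3)
proof (induction k)
  case 0
  then show ?case
    using assms geometric_sums[of "\<phi> * x"] by (simp add: power_mult_distrib)
next
  case (Suc k)
  define y where "y = (real (Suc k) + \<phi>) * x"
  have y: "0 \<le> y" "y < 1" using Suc.prems assms by (auto simp: y_def)
  \<comment> \<open>The convergence condition is strictest for the last factor, so it passes down to
    the induction hypothesis.\<close>
  have "(real k + \<phi>) * x \<le> y" using assms by (auto simp: y_def intro!: mult_right_mono)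
  then have IH: "(\<lambda>t. noncentral_stirling2 (k + t) k \<phi> * x ^ t) sums
      (\<Prod>j\<le>k. 1 / (1 - (real j + \<phi>) * x))"
    using Suc.IH y by auto
  have geo: "(\<lambda>t. y ^ t) sums (1 / (1 - y))" using y by (intro geometric_sums) auto
  have "(\<lambda>t. \<Sum>j\<le>t. y ^ j * (noncentral_stirling2 (k + (t - j)) k \<phi> * x ^ (t - j))) sums
      ((\<Sum>t. y ^ t) * (\<Sum>t. noncentral_stirling2 (k + t) k \<phi> * x ^ t))"
    using IH geo y assms
    by (intro Cauchy_product_sums)
       (auto simp: noncentral_stirling2_nonneg abs_mult sums_iff)
  also have "(\<lambda>t. \<Sum>j\<le>t. y ^ j * (noncentral_stirling2 (k + (t - j)) k \<phi> * x ^ (t - j))) =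
      (\<lambda>t. noncentral_stirling2 (Suc k + t) (Suc k) \<phi> * x ^ t)"
  proof
    fix t
    have "y ^ j * (noncentral_stirling2 (k + (t - j)) k \<phi> * x ^ (t - j)) =
        (real (Suc k) + \<phi>) ^ j * noncentral_stirling2 (k + (t - j)) k \<phi> * x ^ t" if "j \<le> t" for j
      using power_add[of x j "t - j"] that by (simp add: y_def power_mult_distrib mult_ac)
    then show "(\<Sum>j\<le>t. y ^ j * (noncentral_stirling2 (k + (t - j)) k \<phi> * x ^ (t - j))) =
        noncentral_stirling2 (Suc k + t) (Suc k) \<phi> * x ^ t"
      unfolding noncentral_stirling2_conv_sum sum_distrib_right by (intro sum.cong refl) simp
  qed
  finally show ?case
    using IH geo by (simp add: sums_iff y_def mult_ac)
qed

section \<open>The probability generating function\<close>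

text \<open>The success probability of stage \<open>i\<close> of the occupancy process, in which \<open>i\<close> of the
  \<open>m\<close> bins are already occupied.\<close>
definition occ_prob :: "nat \<Rightarrow> real \<Rightarrow> nat \<Rightarrow> real" where
  "occ_prob m \<theta> i = \<theta> * (1 - real i / real m)"

lemma occ_prob_bounds:
  assumes "0 < \<theta>" "\<theta> \<le> 1" "i < m"
  shows "0 < occ_prob m \<theta> i" "occ_prob m \<theta> i \<le> 1"
proof -
  have "0 < 1 - real i / real m" "1 - real i / real m \<le> 1" using assms by auto
  then show "0 < occ_prob m \<theta> i" "occ_prob m \<theta> i \<le> 1"
    using assms by (auto simp: occ_prob_def intro: mult_le_one)
qed

text \<open>Later stages succeed less often, so the last stage decides where the generating function
  converges.\<close>

lemma occ_prob_antimono: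
  assumes "0 < \<theta>" "i \<le> j"
  shows "occ_prob m \<theta> j \<le> occ_prob m \<theta> i"
  using assms by (auto simp: occ_prob_def intro!: mult_left_mono divide_right_mono)

lemma neg_occ_nonneg:
  assumes "0 < \<theta>" "\<theta> \<le> 1" "k \<le> m"
  shows "0 \<le> neg_occ m k \<theta> t"
  unfolding neg_occ_def falling_fact_def using assms
  by (intro mult_nonneg_nonneg divide_nonneg_nonneg prod_nonneg noncentral_stirling2_nonneg) auto

text \<open>Hence the distribution is that of a sum of independent geometric variables.\<close>
lemma neg_occ_pgf:
  assumes \<theta>: "0 < \<theta>" "\<theta> \<le> 1" and k: "0 < k" "k \<le> m"
    and z: "0 \<le> z" "(1 - occ_prob m \<theta> (k - 1)) * z < 1"
  shows "(\<lambda>t. neg_occ m k \<theta> t * z ^ t) sums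
    (\<Prod>i<k. occ_prob m \<theta> i / (1 - (1 - occ_prob m \<theta> i) * z))"
proof -
  obtain n where n: "k = Suc n" using k by (cases k) auto
  define \<phi> where "\<phi> = real m * ((1 - \<theta>) / \<theta>)"
  \<comment> \<open>\<open>\<phi>\<close> and \<open>x\<close> are matched so that
    \<open>(j + \<phi>) * x\<close> is the failure probability of stage \<open>j\<close> times
    \<open>z\<close>.\<close>
  define x where "x = \<theta> * z / real m"
  have m: "real m > 0" using k by simp
  have eq: "(real j + \<phi>) * x = (1 - occ_prob m \<theta> j) * z" for j
    using \<theta> m by (simp add: \<phi>_def x_def occ_prob_def field_simps)
  have "(\<lambda>t. noncentral_stirling2 (n + t) n \<phi> * x ^ t) sums (\<Prod>j\<le>n. 1 / (1 - (real j + \<phi>) * x))"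
    using \<theta> z m eq[of n] n by (intro noncentral_stirling2_gf) (auto simp: \<phi>_def x_def)
  then have "(\<lambda>t. (\<theta> ^ k / real m ^ k * falling_fact (real m) k) *
        (noncentral_stirling2 (n + t) n \<phi> * x ^ t)) sums
      ((\<theta> ^ k / real m ^ k * falling_fact (real m) k) * (\<Prod>j\<le>n. 1 / (1 - (real j + \<phi>) * x)))"
    by (rule sums_mult)
  also have "(\<lambda>t. (\<theta> ^ k / real m ^ k * falling_fact (real m) k) *
        (noncentral_stirling2 (n + t) n \<phi> * x ^ t)) = (\<lambda>t. neg_occ m k \<theta> t * z ^ t)"
    by (auto simp: neg_occ_def n \<phi>_def x_def power_add power_mult_distrib power_divide mult_ac)
  also have "\<theta> ^ k / real m ^ k * falling_fact (real m) k = (\<Prod>i<k. occ_prob m \<theta> i)"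
  proof -
    have "(\<Prod>i<k. occ_prob m \<theta> i) = (\<Prod>i<k. (\<theta> / real m) * (real m - real i))"
      using m by (intro prod.cong) (auto simp: occ_prob_def field_simps)
    then show ?thesis
      unfolding falling_fact_def prod.distrib by (simp add: power_divide)
  qed
  finally show ?thesis
    by (simp add: eq n lessThan_Suc_atMost prod_dividef)
qed

section \<open>Cumulants of the geometric distribution and their integrals\<close>

text \<open>For a geometric variable with success probability \<open>p\<close>, put \<open>w = 1 / (1 - (1 - p) * exp s)\<close>.
  Since \<open>dw/ds = w\<^sup>2 - w\<close>, all derivatives of its cumulant function are polynomials in \<open>w\<close>.\<close>
fun geom_cumulant_poly :: "nat \<Rightarrow> real poly" where
  "geom_cumulant_poly 0 = 0"
| "geom_cumulant_poly (Suc 0) = [:-1, 1:]"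
| "geom_cumulant_poly (Suc r) = [:0, -1, 1:] * pderiv (geom_cumulant_poly r)"

text \<open>Order 0 is the cumulant function itself, a logarithm rather than a polynomial in
  \<open>w\<close>; hence the case distinction. All orders form one family in which each member is
  the derivative of the preceding one.\<close>

definition geom_cgf_deriv :: "nat \<Rightarrow> real \<Rightarrow> real \<Rightarrow> real" where
  "geom_cgf_deriv r p s =
     (if r = 0 then ln p - ln (1 - (1 - p) * exp s)
      else poly (geom_cumulant_poly r) (1 / (1 - (1 - p) * exp s)))"

lemma has_real_derivative_geom_cgf_deriv:
  assumes "(1 - p) * exp s < 1"
  shows "(geom_cgf_deriv r p has_real_derivative geom_cgf_deriv (Suc r) p s) (at s)"
proof (cases r)
  case 0
  have "((\<lambda>s. ln p - ln (1 - (1 - p) * exp s)) has_real_derivative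
      1 / (1 - (1 - p) * exp s) - 1) (at s)"
    using assms by (auto intro!: derivative_eq_intros simp: field_simps)
  then show ?thesis using 0 by (simp add: geom_cgf_deriv_def [abs_def])
next
  case (Suc n)
  define w where "w s = 1 / (1 - (1 - p) * exp s)" for s
  have "(w has_real_derivative poly [:0, -1, 1:] (w s)) (at s)"
    unfolding w_def using assms
    by (auto intro!: derivative_eq_intros simp: field_simps power2_eq_square)
  then have "((\<lambda>s. poly (geom_cumulant_poly r) (w s)) has_real_derivative
      poly (pderiv (geom_cumulant_poly r)) (w s) * poly [:0, -1, 1:] (w s)) (at s)"
    by (rule DERIV_chain2[OF poly_DERIV])
  also have "poly (pderiv (geom_cumulant_poly r)) (w s) * poly [:0, -1, 1:] (w s) =
      geom_cgf_deriv (Suc r) p s"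
    using Suc by (simp add: geom_cgf_deriv_def w_def algebra_simps diff_divide_distrib)
  finally show ?thesis
    using Suc by (simp add: geom_cgf_deriv_def [abs_def] w_def)
qed

text \<open>A derivative depends only on values near the point, so on an open set the identity with
  \<open>F n\<close> may be differentiated again. This reduces iterated \<open>deriv\<close> to
  exhibiting a chain of derivatives.\<close>

lemma higher_deriv_eqI:
  fixes F :: "nat \<Rightarrow> 'a::real_normed_field \<Rightarrow> 'a"
  assumes "open U" "x \<in> U"
    and "\<And>y. y \<in> U \<Longrightarrow> f y = F 0 y"
    and "\<And>n y. y \<in> U \<Longrightarrow> (F n has_field_derivative F (Suc n) y) (at y)"
  shows "(deriv ^^ n) f x = F n x"
  using assms(2)
proof (induction n arbitrary: x)
  case 0
  then show ?case using assms(3) by simp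
next
  case (Suc n)
  have "eventually (\<lambda>y. (deriv ^^ n) f y = F n y) (nhds x)"
    using assms(1) Suc eventually_nhds by blast
  then have "deriv ((deriv ^^ n) f) x = deriv (F n) x"
    by (intro deriv_cong_ev refl)
  also have "\<dots> = F (Suc n) x" using assms(4) Suc.prems by (intro DERIV_imp_deriv) auto
  finally show ?case by simp
qed

section \<open>Integrals of the geometric cumulant functions over the stages\<close>

lemma open_mult_exp_less: "open {s::real. q * exp s < 1}"
  by (intro open_Collect_less continuous_intros)

text \<open>Since \<open>q * exp s\<close> is nondecreasing, the set is an interval. Convexity is
  required by the Leibniz rule for integrals.\<close>

lemma convex_mult_exp_less:
  assumes "0 \<le> q"
  shows "convex {s::real. q * exp s < 1}"
  unfolding is_interval_convex_1 [symmetric] is_interval_1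
  using assms by (auto intro: le_less_trans[OF mult_left_mono])

text \<open>This is the limit of the \<open>r\<close>th cumulant divided by \<open>m\<close>;
  \<open>x\<close> stands for the fraction of bins already occupied.\<close>

definition limit_cumulant :: "nat \<Rightarrow> real \<Rightarrow> real \<Rightarrow> real" where
  "limit_cumulant r l \<theta> = integral {0..l} (\<lambda>x. geom_cgf_deriv r (\<theta> * (1 - x)) 0)"

text \<open>The success probability decreases in \<open>x\<close>, so positivity of the denominator
  at \<open>l\<close> gives one range of \<open>s\<close> that serves all \<open>x\<close> up to
  \<open>l\<close>.\<close>

lemma geom_cgf_denom_pos:
  fixes \<theta> x l s :: real
  assumes "0 < \<theta>" "x \<le> l" "(1 - \<theta> * (1 - l)) * exp s < 1"
  shows "(1 - \<theta> * (1 - x)) * exp s < 1"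
proof -
  have "\<theta> * (1 - l) \<le> \<theta> * (1 - x)" using assms by (intro mult_left_mono) auto
  then have "(1 - \<theta> * (1 - x)) * exp s \<le> (1 - \<theta> * (1 - l)) * exp s"
    by (intro mult_right_mono) auto
  then show ?thesis using assms(3) by (rule le_less_trans)
qed

lemma continuous_on_geom_cgf_deriv:
  assumes "0 < \<theta>" "l < 1" "r > 0"
  shows "continuous_on ({s. (1 - \<theta> * (1 - l)) * exp s < 1} \<times> {0..l})
    (\<lambda>(s, x). geom_cgf_deriv r (\<theta> * (1 - x)) s)"
  using assms geom_cgf_denom_pos[OF assms(1)]
  unfolding geom_cgf_deriv_def case_prod_unfold
  by (force intro!: continuous_intros)

text \<open>The integrand is a sum of logarithms of affine functions of \<open>x\<close>, so the
  antiderivative is built from \<open>u * ln u\<close>. All arguments are positive on the range,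
  which removes the absolute values in the asymptotic form.\<close>

lemma integral_geom_cgf:
  assumes \<theta>: "0 < \<theta>" and l: "0 \<le> l" "l < 1"
    and s: "(1 - \<theta> * (1 - l)) * exp s < 1"
  shows "((\<lambda>x. geom_cgf_deriv 0 (\<theta> * (1 - x)) s) has_integral
     asymp_cumulant_function 1 l \<theta> s) {0..l}"
proof -
  define a b where "a = 1 - (1 - \<theta>) * exp s" and "b = \<theta> * exp s"
  define \<Phi> where "\<Phi> x = x * ln \<theta> - (1 - x) * ln (1 - x) + (a - b * x) * ln (a - b * x) / b" for x
  have b: "b > 0" using \<theta> by (simp add: b_def)
  have ab: "a - b * x = 1 - (1 - \<theta> * (1 - x)) * exp s" for x
    by (simp add: a_def b_def algebra_simps)
  have pos: "a - b * x > 0" if "x \<le> l" for x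
    using geom_cgf_denom_pos[OF \<theta> that s] by (simp add: ab)
  have "(\<Phi> has_vector_derivative geom_cgf_deriv 0 (\<theta> * (1 - x)) s) (at x within {0..l})"
    if x: "x \<in> {0..l}" for x
  proof -
    have xlnx: "((\<lambda>x. x * ln x) has_real_derivative ln u + 1) (at u)" if "0 < u" for u :: real
      using that by (auto intro!: derivative_eq_intros)
    have "((\<lambda>x. (1 - x) * ln (1 - x)) has_real_derivative (ln (1 - x) + 1) * (-1)) (at x)"
      using x l by (intro DERIV_chain2[OF xlnx]) (auto intro!: derivative_eq_intros)
    moreover have "((\<lambda>x. (a - b * x) * ln (a - b * x)) has_real_derivative
        (ln (a - b * x) + 1) * (- b)) (at x)"
      using x pos[of x] by (intro DERIV_chain2[OF xlnx]) (auto intro!: derivative_eq_intros)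
    ultimately have "(\<Phi> has_real_derivative
        ln \<theta> - (ln (1 - x) + 1) * (-1) + (ln (a - b * x) + 1) * (- b) / b) (at x)"
      unfolding \<Phi>_def
      by (intro DERIV_add DERIV_diff DERIV_cdivide) (auto intro!: derivative_eq_intros)
    \<comment> \<open>The constants from the derivative \<open>ln u + 1\<close> of
      \<open>u * ln u\<close> cancel.\<close>
    also have "ln \<theta> - (ln (1 - x) + 1) * (-1) + (ln (a - b * x) + 1) * (- b) / b =
        ln \<theta> + ln (1 - x) - ln (a - b * x)"
      using b by simp
    finally have "(\<Phi> has_real_derivative ln \<theta> + ln (1 - x) - ln (a - b * x)) (at x)" .
    moreover have "ln \<theta> + ln (1 - x) - ln (a - b * x) = geom_cgf_deriv 0 (\<theta> * (1 - x)) s"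
      using \<theta> x l by (simp add: geom_cgf_deriv_def ln_mult ab)
    ultimately show ?thesis
      by (simp add: has_field_derivative_at_within
          flip: has_real_derivative_iff_has_vector_derivative)
  qed
  then have "((\<lambda>x. geom_cgf_deriv 0 (\<theta> * (1 - x)) s) has_integral (\<Phi> l - \<Phi> 0)) {0..l}"
    using l by (intro fundamental_theorem_of_calculus) auto
  also have "\<Phi> l - \<Phi> 0 = asymp_cumulant_function 1 l \<theta> s"
    using l pos[of l] pos[of 0]
    by (simp add: \<Phi>_def asymp_cumulant_function_def a_def b_def mult_ac)
  finally show ?thesis .
qed

text \<open>The asymptotic cumulant function is \<open>m\<close> times an integral over the stages,
  and it is differentiated under the integral sign.\<close>

lemma asymp_cumulant_eq:
  assumes \<theta>: "0 < \<theta>" "\<theta> \<le> 1" and l: "0 \<le> l" "l < 1"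
  shows "asymp_cumulant r m l \<theta> = real m * limit_cumulant r l \<theta>"
proof -
  define U where "U = {s. (1 - \<theta> * (1 - l)) * exp s < 1}"
  have q: "0 \<le> 1 - \<theta> * (1 - l)" "1 - \<theta> * (1 - l) < 1"
    using \<theta> l mult_le_one[of \<theta> "1 - l"] by auto
  have "(deriv ^^ r) (asymp_cumulant_function m l \<theta>) 0 =
      real m * integral {0..l} (\<lambda>x. geom_cgf_deriv r (\<theta> * (1 - x)) 0)"
  proof (rule higher_deriv_eqI[where U = U and
      F = "\<lambda>r s. real m * integral {0..l} (\<lambda>x. geom_cgf_deriv r (\<theta> * (1 - x)) s)"])
    show "open U" "0 \<in> U" using q by (auto simp: U_def open_mult_exp_less)
  next
    fix s assume "s \<in> U"
    then have "integral {0..l} (\<lambda>x. geom_cgf_deriv 0 (\<theta> * (1 - x)) s) = asymp_cumulant_function 1 l \<theta> s"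
      using integral_geom_cgf[OF \<theta>(1) l] by (intro integral_unique) (simp add: U_def)
    then show "asymp_cumulant_function m l \<theta> s =
        real m * integral {0..l} (\<lambda>x. geom_cgf_deriv 0 (\<theta> * (1 - x)) s)"
      by (simp add: asymp_cumulant_function_def)
  next
    fix n s assume s: "s \<in> U"
    \<comment> \<open>Order 0 is integrable by its explicit antiderivative; the joint continuity
      lemma covers the positive orders.\<close>
    have int: "(\<lambda>x. geom_cgf_deriv n (\<theta> * (1 - x)) s) integrable_on cbox 0 l" if "s \<in> U" for s
    proof (cases "n = 0")
      case True
      then show ?thesis
        using integral_geom_cgf[OF \<theta>(1) l] that by (auto simp: U_def has_integral_integrable)
    next
      case False
      then have "continuous_on {0..l}
          (\<lambda>x. (\<lambda>(s, x). geom_cgf_deriv n (\<theta> * (1 - x)) s) (s, x))"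
        using that \<theta> l
        by (intro continuous_on_compose2[OF continuous_on_geom_cgf_deriv, of \<theta> l n])
           (auto simp: U_def intro!: continuous_intros)
      then show ?thesis
        by (simp add: integrable_continuous_real)
    qed
    have "((\<lambda>s. integral (cbox 0 l) (\<lambda>x. geom_cgf_deriv n (\<theta> * (1 - x)) s)) has_field_derivative
        integral (cbox 0 l) (\<lambda>x. geom_cgf_deriv (Suc n) (\<theta> * (1 - x)) s)) (at s within U)"
    proof (rule leibniz_rule_field_derivative)
      fix s x assume "s \<in> U" "x \<in> cbox 0 l"
      then show "((\<lambda>s. geom_cgf_deriv n (\<theta> * (1 - x)) s) has_field_derivative
          geom_cgf_deriv (Suc n) (\<theta> * (1 - x)) s) (at s within U)"
        using geom_cgf_denom_pos[OF \<theta>(1), of x l s]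
        by (auto simp: U_def intro!: has_field_derivative_at_within has_real_derivative_geom_cgf_deriv)
    next
      show "continuous_on (U \<times> cbox 0 l) (\<lambda>(s, x). geom_cgf_deriv (Suc n) (\<theta> * (1 - x)) s)"
        using continuous_on_geom_cgf_deriv \<theta> l by (simp add: U_def)
    qed (use int s q in \<open>auto simp: U_def convex_mult_exp_less\<close>)
    then show "((\<lambda>s. real m * integral {0..l} (\<lambda>x. geom_cgf_deriv n (\<theta> * (1 - x)) s))
        has_field_derivative
        real m * integral {0..l} (\<lambda>x. geom_cgf_deriv (Suc n) (\<theta> * (1 - x)) s)) (at s)"
      using at_within_open[OF s] by (auto simp: U_def open_mult_exp_less intro!: DERIV_cmult)
  qed
  then show ?thesis by (simp add: asymp_cumulant_def limit_cumulant_def)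
qed

lemma geom_cgf_deriv_at_0:
  assumes "0 < r"
  shows "geom_cgf_deriv r p 0 = poly (geom_cumulant_poly r) (1 / p)"
  using assms by (simp add: geom_cgf_deriv_def)

text \<open>The derivative in \<open>x\<close> is continuous on \<open>{0..b}\<close>, because
  \<open>b < 1\<close> keeps the success probability away from 0, and so it is bounded there. The
  constant controls the Riemann sum error.\<close>

lemma geom_cumulant_lipschitz:
  assumes "0 < \<theta>" "b < 1" "0 < r"
  obtains C where "0 \<le> C" "\<And>x y. x \<in> {0..b} \<Longrightarrow> y \<in> {0..b} \<Longrightarrow>
    \<bar>geom_cgf_deriv r (\<theta> * (1 - x)) 0 - geom_cgf_deriv r (\<theta> * (1 - y)) 0\<bar> \<le> C * \<bar>x - y\<bar>"
proof -
  define g' where "g' x = poly (pderiv (geom_cumulant_poly r)) (1 / (\<theta> * (1 - x))) *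
      (\<theta> / (\<theta> * (1 - x))\<^sup>2)" for x
  have deriv: "((\<lambda>x. geom_cgf_deriv r (\<theta> * (1 - x)) 0) has_real_derivative g' x) (at x within {0..b})"
    if "x \<in> {0..b}" for x
  proof -
    have "((\<lambda>x. 1 / (\<theta> * (1 - x))) has_real_derivative \<theta> / (\<theta> * (1 - x))\<^sup>2) (at x within {0..b})"
      using assms that by (auto intro!: derivative_eq_intros simp: power2_eq_square)
    then show ?thesis
      unfolding geom_cgf_deriv_at_0[OF assms(3)] g'_def by (rule DERIV_chain2[OF poly_DERIV])
  qed
  have "continuous_on {0..b} g'"
    unfolding g'_def using assms by (auto intro!: continuous_intros)
  then have "bounded (g' ` {0..b})"
    by (intro compact_imp_bounded compact_continuous_image) auto
  then obtain C where C: "C > 0" "\<And>x. x \<in> {0..b} \<Longrightarrow> norm (g' x) \<le> C"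
    unfolding bounded_pos by auto
  show ?thesis
    by (rule that[of C]) (use C field_differentiable_bound[OF _ deriv, of C] in auto)
qed

section \<open>Moments and cumulants of the negative occupancy distribution\<close>

text \<open>Convergence at \<open>K > 1\<close> puts 1 inside the disc, so the series may be
  differentiated termwise twice there. The second derivative yields the factorial moment; adding the
  first gives the second moment.\<close>

lemma power_series_moments:
  fixes c :: "nat \<Rightarrow> real"
  assumes K: "1 < K" "summable (\<lambda>n. c n * K ^ n)"
    and U: "open U" "1 \<in> U"
    and F: "\<And>z. z \<in> U \<Longrightarrow> (\<Sum>n. c n * z ^ n) = F z"
    and F': "\<And>z. z \<in> U \<Longrightarrow> (F has_real_derivative F' z) (at z)"
    and F'': "(F' has_real_derivative D) (at 1)"
  shows "(\<lambda>n. c n * real n) sums F' 1" "(\<lambda>n. c n * (real n)\<^sup>2) sums (D + F' 1)"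
proof -
  have sm: "summable (\<lambda>n. c n * z ^ n)" if "norm z < K" for z
    using powser_inside[OF K(2)] that K(1) by auto
  have sm1: "summable (\<lambda>n. diffs c n * z ^ n)" if "norm z < K" for z
    using termdiff_converges[OF that sm] .
  have sm2: "summable (\<lambda>n. diffs (diffs c) n * z ^ n)" if "norm z < K" for z
    using termdiff_converges[OF that sm1] .
  have F'_eq: "(\<Sum>n. diffs c n * z ^ n) = F' z" if z: "z \<in> U \<inter> ball 0 K" for z
  proof -
    have "((\<lambda>z. \<Sum>n. c n * z ^ n) has_real_derivative (\<Sum>n. diffs c n * z ^ n)) (at z)"
      using z by (intro termdiffs_strong'[OF sm]) auto
    then have "(F has_real_derivative (\<Sum>n. diffs c n * z ^ n)) (at z)"
      by (rule has_field_derivative_transform_within_open[OF _ U(1)]) (use z F in auto)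
    then show ?thesis using F' z DERIV_unique by blast
  qed
  have "((\<lambda>z. \<Sum>n. diffs c n * z ^ n) has_real_derivative (\<Sum>n. diffs (diffs c) n * 1 ^ n)) (at 1)"
    using K by (intro termdiffs_strong'[OF sm1]) auto
  then have "(F' has_real_derivative (\<Sum>n. diffs (diffs c) n * 1 ^ n)) (at 1)"
    by (rule has_field_derivative_transform_within_open[of _ _ _ "U \<inter> ball 0 K"])
       (use U K F'_eq in auto)
  then have D: "D = (\<Sum>n. diffs (diffs c) n)" using F'' DERIV_unique by fastforce
  have "(\<lambda>n. c (Suc n) * real (Suc n)) sums F' 1"
    using sm1[of 1] F'_eq[of 1] K U by (simp add: diffs_def sums_iff mult_ac)
  from sums_Suc[OF this] show 1: "(\<lambda>n. c n * real n) sums F' 1" by simp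
  \<comment> \<open>\<open>f\<close> vanishes at 0 and 1, so shifting the index by two loses
    nothing.\<close>
  define f where "f n = c n * (real n * (real n - 1))" for n
  have "(\<lambda>n. f (Suc (Suc n))) sums D"
    using sm2[of 1] D K by (simp add: diffs_def sums_iff f_def mult_ac)
  from sums_Suc[OF sums_Suc[OF this]] have "f sums D" by (simp add: f_def [abs_def])
  from sums_add[OF this 1] show "(\<lambda>n. c n * (real n)\<^sup>2) sums (D + F' 1)"
    by (simp add: f_def algebra_simps power2_eq_square)
qed

section \<open>Exact moments and cumulants for one fixed choice of parameters\<close>

locale neg_occ_distributed = prob_space +
  fixes T :: "'a \<Rightarrow> nat" and m k :: nat and \<theta> :: real
  assumes theta: "0 < \<theta>" "\<theta> \<le> 1"
    and k: "0 < k" "k \<le> m"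
    and distr: "distributed M (count_space UNIV) T (\<lambda>t. ennreal (neg_occ m k \<theta> t))"
begin

abbreviation p :: "nat \<Rightarrow> real" where
  "p \<equiv> occ_prob m \<theta>"

text \<open>The failure probability of the last stage, the largest of all, so
  \<open>q * z < 1\<close> is the convergence condition for every factor.\<close>

abbreviation q :: real where
  "q \<equiv> 1 - p (k - 1)"

lemma p: "i < k \<Longrightarrow> 0 < p i" "i < k \<Longrightarrow> p i \<le> 1"
  using occ_prob_bounds[OF theta, of i m] k by auto

lemma q: "0 \<le> q" "q < 1"
  using p[of "k - 1"] k by auto

lemma denom_pos:
  assumes "i < k" "0 \<le> z" "q * z < 1"
  shows "(1 - p i) * z < 1"
proof -
  have "(1 - p i) * z \<le> q * z"
    using assms occ_prob_antimono[OF theta(1), of i "k - 1" m] by (intro mult_right_mono) auto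
  then show ?thesis using assms by simp
qed

lemma pgf:
  assumes "0 \<le> z" "q * z < 1"
  shows "(\<lambda>t. neg_occ m k \<theta> t * z ^ t) sums (\<Prod>i<k. p i / (1 - (1 - p i) * z))"
  using neg_occ_pgf theta k assms by blast

text \<open>Expectations are taken as sums against the mass function. For nonnegative
  \<open>g\<close> summability is already absolute, which gives integrability.\<close>

lemma
  fixes g :: "nat \<Rightarrow> real"
  assumes "\<And>t. 0 \<le> g t" "(\<lambda>t. neg_occ m k \<theta> t * g t) sums S"
  shows integrable_nonneg: "integrable M (\<lambda>\<omega>. g (T \<omega>))"
    and expectation_nonneg: "expectation (\<lambda>\<omega>. g (T \<omega>)) = S"
proof -
  note nonneg = neg_occ_nonneg[OF theta k(2)]
  have int: "integrable (count_space UNIV) (\<lambda>t. neg_occ m k \<theta> t * g t)"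
    using assms nonneg by (simp add: integrable_count_space_nat_iff abs_mult sums_iff)
  then show "integrable M (\<lambda>\<omega>. g (T \<omega>))"
    using distributed_integrable[OF distr, of g] nonneg by simp
  show "expectation (\<lambda>\<omega>. g (T \<omega>)) = S"
    using distributed_integral[OF distr, of g] nonneg integral_count_space_nat[OF int] assms
    by (simp add: sums_iff)
qed

text \<open>\<open>H\<close> is the logarithmic derivative of the generating function
  \<open>F\<close>. From \<open>F 1 = 1\<close> and \<open>F' = F * H\<close> follow
  \<open>F' 1 = H 1\<close> and second derivative \<open>(H 1)\<^sup>2 + D\<close> at 1, where
  \<open>D\<close> is the derivative of \<open>H\<close> there.\<close>

lemma moments:
  "(\<lambda>t. neg_occ m k \<theta> t * real t) sums (\<Sum>i<k. 1 / p i - 1)"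
  "(\<lambda>t. neg_occ m k \<theta> t * (real t)\<^sup>2) sums
     ((\<Sum>i<k. 1 / (p i)\<^sup>2 - 1 / p i) + (\<Sum>i<k. 1 / p i - 1)\<^sup>2)"
proof -
  define U where "U = {z. 0 < z} \<inter> {z. q * z < 1}"
  define F where "F z = (\<Prod>i<k. p i / (1 - (1 - p i) * z))" for z
  define H where "H z = (\<Sum>i<k. (1 - p i) / (1 - (1 - p i) * z))" for z
  have U: "open U" "1 \<in> U"
    using q k p[of "k - 1"] unfolding U_def by (auto intro!: open_Int open_Collect_less continuous_intros)
  have F1: "F 1 = 1" and H1: "H 1 = (\<Sum>i<k. 1 / p i - 1)"
    using p by (force simp: F_def H_def diff_divide_distrib intro!: prod.neutral sum.cong)+
  have F': "(F has_real_derivative F z * H z) (at z)" if z: "z \<in> U" for z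
  proof -
    \<comment> \<open>The product is written as the exponential of a sum of logarithms, so that its
      derivative is a sum.\<close>
    have eq: "exp (\<Sum>i<k. ln (p i) - ln (1 - (1 - p i) * z)) = F z" if "z \<in> U" for z
      using that p denom_pos[of _ z]
      by (auto simp: F_def U_def exp_sum exp_diff intro!: prod.cong)
    have "((\<lambda>z. exp (\<Sum>i<k. ln (p i) - ln (1 - (1 - p i) * z))) has_real_derivative
        exp (\<Sum>i<k. ln (p i) - ln (1 - (1 - p i) * z)) *
        (\<Sum>i<k. (1 - p i) / (1 - (1 - p i) * z))) (at z)"
      using z denom_pos[of _ z]
      by (intro DERIV_chain2[OF DERIV_exp] DERIV_sum)
         (auto intro!: derivative_eq_intros simp: U_def minus_divide_left)
    then have "((\<lambda>z. exp (\<Sum>i<k. ln (p i) - ln (1 - (1 - p i) * z))) has_real_derivative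
        F z * H z) (at z)"
      unfolding H_def eq[OF z] .
    then show ?thesis
      by (rule has_field_derivative_transform_within_open[OF _ U(1) z eq])
  qed
  define D where "D = (\<Sum>i<k. ((1 - p i) / p i)\<^sup>2)"
  have "(H has_real_derivative D) (at 1)"
    unfolding H_def D_def
  proof (intro DERIV_sum)
    fix i assume "i \<in> {..<k}"
    then have "p i \<noteq> 0" using p by force
    then show "((\<lambda>z. (1 - p i) / (1 - (1 - p i) * z)) has_real_derivative ((1 - p i) / p i)\<^sup>2) (at 1)"
      by (auto intro!: derivative_eq_intros
          simp: power2_eq_square minus_divide_left minus_mult_right simp del: mult_minus_right)
  qed
  from DERIV_mult[OF F'[OF U(2)] this]
  have F'': "((\<lambda>z. F z * H z) has_real_derivative (H 1)\<^sup>2 + D) (at 1)"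
    by (simp add: F1 power2_eq_square mult_ac add_ac)
  \<comment> \<open>Any \<open>K\<close> above 1 with \<open>q * K < 1\<close> serves; this one
    works because \<open>q < 1\<close> gives \<open>2 * q < 1 + q < 2\<close>.\<close>
  define K where "K = 2 / (1 + q)"
  have K: "1 < K" "q * K < 1" using q by (auto simp: K_def field_simps)
  have "summable (\<lambda>t. neg_occ m k \<theta> t * K ^ t)"
    using pgf[of K] K by (simp add: sums_iff)
  note moments = power_series_moments[OF K(1) this U _ F' F'']
  have sum: "(\<Sum>t. neg_occ m k \<theta> t * z ^ t) = F z" if "z \<in> U" for z
    using pgf[of z] that by (simp add: U_def F_def sums_iff)
  show "(\<lambda>t. neg_occ m k \<theta> t * real t) sums (\<Sum>i<k. 1 / p i - 1)"
    using moments(1)[OF sum] by (simp add: F1 H1)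
  have "D + H 1 = (\<Sum>i<k. 1 / (p i)\<^sup>2 - 1 / p i)"
    unfolding D_def H1 sum.distrib [symmetric]
  proof (intro sum.cong refl)
    fix i assume "i \<in> {..<k}"
    then have "p i \<noteq> 0" using p by force
    then show "((1 - p i) / p i)\<^sup>2 + (1 / p i - 1) = 1 / (p i)\<^sup>2 - 1 / p i"
      by (simp add: field_simps power2_eq_square)
  qed
  from this [symmetric] show "(\<lambda>t. neg_occ m k \<theta> t * (real t)\<^sup>2) sums
     ((\<Sum>i<k. 1 / (p i)\<^sup>2 - 1 / p i) + (\<Sum>i<k. 1 / p i - 1)\<^sup>2)"
    using moments(2)[OF sum] by (simp add: F1 H1 add_ac)
qed

lemma expectation_T: "expectation (\<lambda>\<omega>. real (T \<omega>)) = (\<Sum>i<k. geom_cgf_deriv 1 (p i) 0)"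
  using expectation_nonneg[OF _ moments(1)] by (simp add: geom_cgf_deriv_at_0)

text \<open>The squared mean in the second moment cancels, which leaves the sum of the geometric
  variances.\<close>

lemma variance_T: "variance (\<lambda>\<omega>. real (T \<omega>)) = (\<Sum>i<k. geom_cgf_deriv 2 (p i) 0)"
proof -
  have "variance (\<lambda>\<omega>. real (T \<omega>)) = (\<Sum>i<k. 1 / (p i)\<^sup>2 - 1 / p i)"
    using expectation_nonneg[OF _ moments(1)] expectation_nonneg[OF _ moments(2)]
      integrable_nonneg[OF _ moments(1)] integrable_nonneg[OF _ moments(2)]
    by (subst variance_eq) simp_all
  moreover have "geom_cgf_deriv 2 x 0 = 1 / x\<^sup>2 - 1 / x" for x
    by (simp add: geom_cgf_deriv_at_0 numeral_2_eq_2 pderiv_pCons algebra_simps)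
  ultimately show ?thesis by simp
qed

text \<open>The cumulant function is the logarithm of the generating function at
  \<open>exp (s / c)\<close>, hence a sum of geometric ones; each derivative contributes a factor
  \<open>1 / c\<close>. Taking \<open>c = 1\<close> gives \<open>T\<close> itself.\<close>

lemma cumulant_scaled:
  assumes c: "0 < c"
  shows "cumulant r M (\<lambda>\<omega>. real (T \<omega>) / c) = (\<Sum>i<k. geom_cgf_deriv r (p i) 0) / c ^ r"
proof -
  define U where "U = {s. q * exp (s / c) < 1}"
  have "(deriv ^^ r) (cumulant_function M (\<lambda>\<omega>. real (T \<omega>) / c)) 0 =
      (\<Sum>i<k. geom_cgf_deriv r (p i) (0 / c)) / c ^ r"
  proof (rule higher_deriv_eqI[where U = U and
        F = "\<lambda>r s. (\<Sum>i<k. geom_cgf_deriv r (p i) (s / c)) / c ^ r"])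
    show "open U" unfolding U_def using c by (intro open_Collect_less continuous_intros) auto
    show "0 \<in> U" using p[of "k - 1"] k by (simp add: U_def)
  next
    fix s assume "s \<in> U"
    then have s: "q * exp (s / c) < 1" by (simp add: U_def)
    have "expectation (\<lambda>\<omega>. exp (s / c) ^ T \<omega>) = (\<Prod>i<k. p i / (1 - (1 - p i) * exp (s / c)))"
      using expectation_nonneg[OF _ pgf[OF _ s]] by simp
    also have "(\<lambda>\<omega>. exp (s / c) ^ T \<omega>) = (\<lambda>\<omega>. exp (s * (real (T \<omega>) / c)))"
      by (simp add: exp_of_nat_mult [symmetric] mult_ac)
    finally have "cumulant_function M (\<lambda>\<omega>. real (T \<omega>) / c) s =
        ln (\<Prod>i<k. p i / (1 - (1 - p i) * exp (s / c)))"
      by (simp add: cumulant_function_def)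
    also have "\<dots> = (\<Sum>i<k. ln (p i / (1 - (1 - p i) * exp (s / c))))"
    proof (rule ln_prod)
      fix i assume "i \<in> {..<k}"
      then show "p i / (1 - (1 - p i) * exp (s / c)) \<noteq> 0"
        using p(1)[of i] denom_pos[of i, OF _ _ s] by simp
    qed simp
    also have "\<dots> = (\<Sum>i<k. geom_cgf_deriv 0 (p i) (s / c))"
    proof (intro sum.cong refl)
      fix i assume "i \<in> {..<k}"
      then show "ln (p i / (1 - (1 - p i) * exp (s / c))) = geom_cgf_deriv 0 (p i) (s / c)"
        using p(1)[of i] denom_pos[of i, OF _ _ s] by (simp add: geom_cgf_deriv_def ln_div)
    qed
    finally show "cumulant_function M (\<lambda>\<omega>. real (T \<omega>) / c) s =
        (\<Sum>i<k. geom_cgf_deriv 0 (p i) (s / c)) / c ^ 0" by simp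
  next
    fix n s assume "s \<in> U"
    then have s: "q * exp (s / c) < 1" by (simp add: U_def)
    have "((\<lambda>s. (\<Sum>i<k. geom_cgf_deriv n (p i) (s / c)) / c ^ n) has_real_derivative
        (\<Sum>i<k. geom_cgf_deriv (Suc n) (p i) (s / c) * (1 / c)) / c ^ n) (at s)"
      using denom_pos[OF _ _ s] c
      by (intro DERIV_cdivide DERIV_sum DERIV_chain2[OF has_real_derivative_geom_cgf_deriv])
         (auto intro!: derivative_eq_intros)
    then show "((\<lambda>s. (\<Sum>i<k. geom_cgf_deriv n (p i) (s / c)) / c ^ n) has_real_derivative
        (\<Sum>i<k. geom_cgf_deriv (Suc n) (p i) (s / c)) / c ^ Suc n) (at s)"
      by (simp add: sum_divide_distrib mult_ac)
  qed
  then show ?thesis by (simp add: cumulant_def)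
qed

end

section \<open>Riemann sums\<close>

text \<open>On each of the \<open>k\<close> cells of length \<open>1 / m\<close>, the mean value
  theorem replaces \<open>m\<close> times the increment of \<open>\<Phi>\<close> by a value of
  \<open>g\<close> inside the cell, so the Lipschitz bound costs at most \<open>C / m\<close> per
  cell. The increments telescope.\<close>

lemma riemann_sum_error_bound:
  fixes g \<Phi> :: "real \<Rightarrow> real"
  assumes deriv: "\<And>x. x \<in> {0..b} \<Longrightarrow> (\<Phi> has_real_derivative g x) (at x within {0..b})"
    and lipschitz: "\<And>x y. x \<in> {0..b} \<Longrightarrow> y \<in> {0..b} \<Longrightarrow> \<bar>g x - g y\<bar> \<le> C * \<bar>x - y\<bar>"
    and "0 \<le> C" "0 < m" "real k / real m \<le> b"
  shows "\<bar>(\<Sum>i<k. g (real i / real m)) - real m * (\<Phi> (real k / real m) - \<Phi> 0)\<bar> \<le>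
    C * (real k / real m)"
proof -
  have "\<bar>g (real i / real m) - real m * (\<Phi> (real (Suc i) / real m) - \<Phi> (real i / real m))\<bar> \<le>
      C / real m" if "i < k" for i
  proof -
    define x y where "x = real i / real m" and "y = real (Suc i) / real m"
    have "y \<le> real k / real m" using that \<open>0 < m\<close> by (auto simp: y_def intro!: divide_right_mono)
    then have "y \<le> b" using assms(5) by (rule order_trans)
    then have xy: "0 \<le> x" "x < y" "y \<le> b" "y - x = 1 / real m"
      using assms(4) by (auto simp: x_def y_def field_simps)
    have "\<exists>z\<in>{x<..<y}. \<Phi> y - \<Phi> x = (\<lambda>h. g z * h) (y - x)"
      using xy
      by (intro mvt_simple) (auto intro!: has_field_derivative_imp_has_derivative
          has_field_derivative_subset[OF deriv])
    then obtain z where z: "x < z" "z < y" "\<Phi> y - \<Phi> x = g z / real m" using xy by auto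
    have "\<bar>g x - g z\<bar> \<le> C * \<bar>x - z\<bar>" using z xy by (intro lipschitz) auto
    also have "\<dots> \<le> C * (1 / real m)" using z xy \<open>0 \<le> C\<close> by (intro mult_left_mono) auto
    finally show ?thesis using z \<open>0 < m\<close> by (simp add: x_def y_def)
  qed
  then have "(\<Sum>i<k. \<bar>g (real i / real m) -
      real m * (\<Phi> (real (Suc i) / real m) - \<Phi> (real i / real m))\<bar>) \<le> (\<Sum>i<k. C / real m)"
    by (intro sum_mono) auto
  then have "\<bar>\<Sum>i<k. g (real i / real m) -
      real m * (\<Phi> (real (Suc i) / real m) - \<Phi> (real i / real m))\<bar> \<le> real k * (C / real m)"
    using order_trans[OF sum_abs] by force
  also have "(\<Sum>i<k. g (real i / real m) -
      real m * (\<Phi> (real (Suc i) / real m) - \<Phi> (real i / real m))) =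
      (\<Sum>i<k. g (real i / real m)) - real m * (\<Phi> (real k / real m) - \<Phi> 0)"
    using sum_lessThan_telescope[of "\<lambda>i. \<Phi> (real i / real m)" k]
    by (simp add: sum_subtractf sum_distrib_left [symmetric])
  finally show ?thesis by (simp add: mult_ac)
qed

text \<open>With \<open>x = k / m\<close>, the bound \<open>x \<le> g x\<close> makes the main term
  at least \<open>k * x / 2\<close>, while the error is at most \<open>C * x\<close>. The relative
  error \<open>2 * C / k\<close> tends to 0 even if \<open>k / m\<close> does.\<close>

lemma riemann_sum_asymp_equiv:
  fixes g \<Phi> :: "real \<Rightarrow> real" and m k :: "nat \<Rightarrow> nat"
  assumes deriv: "\<And>x. x \<in> {0..b} \<Longrightarrow> (\<Phi> has_real_derivative g x) (at x within {0..b})"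
    and lipschitz: "\<And>x y. x \<in> {0..b} \<Longrightarrow> y \<in> {0..b} \<Longrightarrow> \<bar>g x - g y\<bar> \<le> C * \<bar>x - y\<bar>"
    and C: "0 \<le> C"
    and lower: "\<And>x. x \<in> {0..b} \<Longrightarrow> x \<le> g x"
    and k: "\<And>N. 0 < k N" "\<And>N. k N \<le> m N" "filterlim k at_top sequentially"
    and b: "eventually (\<lambda>N. real (k N) / real (m N) \<le> b) sequentially"
  shows "(\<lambda>N. \<Sum>i<k N. g (real i / real (m N))) \<sim>[sequentially]
    (\<lambda>N. real (m N) * (\<Phi> (real (k N) / real (m N)) - \<Phi> 0))"
proof (rule asymp_equivI')
  define A where "A N = real (m N) * (\<Phi> (real (k N) / real (m N)) - \<Phi> 0)" for N
  have "eventually (\<lambda>N. norm ((\<Sum>i<k N. g (real i / real (m N))) / A N - 1) \<le> 2 * C / real (k N))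
      sequentially"
    using b
  proof eventually_elim
    case (elim N)
    define x where "x = real (k N) / real (m N)"
    have m: "0 < m N" using k(1,2)[of N] by simp
    have x: "0 < x" "x \<le> b" using elim k(1)[of N] m by (auto simp: x_def)
    \<comment> \<open>The function \<open>\<Phi> x - x\<^sup>2 / 2\<close> has the nonnegative
      derivative \<open>g z - z\<close>, which yields
      \<open>x\<^sup>2 / 2 \<le> \<Phi> x - \<Phi> 0\<close>.\<close>
    have "\<exists>z\<in>{0<..<x}. (\<lambda>x. \<Phi> x - x\<^sup>2 / 2) x - (\<lambda>x. \<Phi> x - x\<^sup>2 / 2) 0 = (\<lambda>h. (g z - z) * h) (x - 0)"
      using x
      by (intro mvt_simple)
         (auto intro!: has_field_derivative_imp_has_derivative derivative_eq_intros
           has_field_derivative_subset[OF deriv])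
    then obtain z where "0 < z" "z < x" "\<Phi> x - x\<^sup>2 / 2 - \<Phi> 0 = (g z - z) * x" by auto
    moreover have "0 \<le> (g z - z) * x"
      using calculation lower[of z] x by (intro mult_nonneg_nonneg) auto
    ultimately have "x\<^sup>2 / 2 \<le> \<Phi> x - \<Phi> 0" by linarith
    then have "real (m N) * (x\<^sup>2 / 2) \<le> A N"
      unfolding A_def x_def [symmetric] by (intro mult_left_mono) auto
    also have "real (m N) * (x\<^sup>2 / 2) = real (k N) * x / 2"
      using m by (simp add: x_def power2_eq_square)
    finally have A: "real (k N) * x / 2 \<le> A N" .
    moreover have "0 < real (k N) * x / 2" using x k(1)[of N] by simp
    ultimately have A_pos: "0 < A N" by linarith
    have "\<bar>(\<Sum>i<k N. g (real i / real (m N))) - A N\<bar> \<le> C * x"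
      unfolding A_def x_def by (rule riemann_sum_error_bound[OF deriv lipschitz C m elim])
    also have "\<dots> = 2 * C / real (k N) * (real (k N) * x / 2)" using k(1)[of N] by simp
    also have "\<dots> \<le> 2 * C / real (k N) * A N" using A C by (intro mult_left_mono) auto
    finally have "\<bar>(\<Sum>i<k N. g (real i / real (m N))) - A N\<bar> / A N \<le> 2 * C / real (k N)"
      using A_pos by (simp add: pos_divide_le_eq)
    also have "\<bar>(\<Sum>i<k N. g (real i / real (m N))) - A N\<bar> / A N =
        \<bar>((\<Sum>i<k N. g (real i / real (m N))) - A N) / A N\<bar>"
      using A_pos by (simp add: abs_divide)
    finally show ?case
      using A_pos by (simp add: diff_divide_distrib)
  qed
  moreover have "(\<lambda>N. 2 * C / real (k N)) \<longlonglongrightarrow> 0"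
    using k(3) by (intro real_tendsto_divide_at_top[OF tendsto_const] filterlim_compose[OF filterlim_real_sequentially])
  ultimately have "(\<lambda>N. (\<Sum>i<k N. g (real i / real (m N))) / A N - 1) \<longlonglongrightarrow> 0"
    by (rule Lim_null_comparison)
  then show "(\<lambda>N. (\<Sum>i<k N. g (real i / real (m N))) /
      (real (m N) * (\<Phi> (real (k N) / real (m N)) - \<Phi> 0))) \<longlonglongrightarrow> 1"
    unfolding A_def by (rule LIM_zero_cancel)
qed

text \<open>After division by \<open>m\<close> the error is \<open>O(1 / m)\<close>, and continuity
  of the integral in its upper limit does the rest. An absolute error suffices here, so no lower
  bound on \<open>g\<close> is asked for.\<close>

lemma riemann_sum_tendsto:
  fixes g :: "real \<Rightarrow> real" and m k :: "nat \<Rightarrow> nat"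
  assumes lipschitz: "\<And>x y. x \<in> {0..b} \<Longrightarrow> y \<in> {0..b} \<Longrightarrow> \<bar>g x - g y\<bar> \<le> C * \<bar>x - y\<bar>"
    and C: "0 \<le> C"
    and m: "\<And>N. 0 < m N" "filterlim m at_top sequentially"
    and lim: "(\<lambda>N. real (k N) / real (m N)) \<longlonglongrightarrow> l" and l: "l < b"
  shows "(\<lambda>N. (\<Sum>i<k N. g (real i / real (m N))) / real (m N)) \<longlonglongrightarrow> integral {0..l} g"
proof -
  define \<Phi> where "\<Phi> x = integral {0..x} g" for x
  have "C-lipschitz_on {0..b} g"
    using lipschitz C by (intro lipschitz_onI) (auto simp: dist_real_def)
  then have deriv: "(\<Phi> has_real_derivative g x) (at x within {0..b})" if "x \<in> {0..b}" for x
    unfolding \<Phi>_def using that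
    by (intro integral_has_real_derivative lipschitz_on_continuous_on)
  have "0 \<le> l" using lim by (rule LIMSEQ_le_const) auto
  have ev: "eventually (\<lambda>N. real (k N) / real (m N) \<le> b) sequentially"
    using order_tendstoD(2)[OF lim l] by eventually_elim simp
  have "(\<lambda>N. \<Phi> (real (k N) / real (m N))) \<longlonglongrightarrow> \<Phi> l"
  proof (rule continuous_on_tendsto_compose[OF _ lim])
    show "continuous_on {0..b} \<Phi>" using DERIV_continuous_on deriv by blast
    show "eventually (\<lambda>N. real (k N) / real (m N) \<in> {0..b}) sequentially"
      using ev by eventually_elim simp
  qed (use l \<open>0 \<le> l\<close> in auto)
  moreover have "(\<lambda>N. (\<Sum>i<k N. g (real i / real (m N))) / real (m N) - \<Phi> (real (k N) / real (m N)))
      \<longlonglongrightarrow> 0"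
  proof (rule Lim_null_comparison)
    show "eventually (\<lambda>N. norm ((\<Sum>i<k N. g (real i / real (m N))) / real (m N) -
        \<Phi> (real (k N) / real (m N))) \<le> C * b / real (m N)) sequentially"
      using ev
    proof eventually_elim
      case (elim N)
      define S where "S = (\<Sum>i<k N. g (real i / real (m N)))"
      define x where "x = real (k N) / real (m N)"
      have "\<bar>S - real (m N) * (\<Phi> x - \<Phi> 0)\<bar> \<le> C * x"
        unfolding S_def x_def by (rule riemann_sum_error_bound[OF deriv lipschitz C m(1) elim])
      also have "\<dots> \<le> C * b" using elim C unfolding x_def by (rule mult_left_mono)
      finally have "\<bar>S - real (m N) * \<Phi> x\<bar> / real (m N) \<le> C * b / real (m N)"
        by (intro divide_right_mono) (auto simp: \<Phi>_def)
      also have "\<bar>S - real (m N) * \<Phi> x\<bar> / real (m N) = \<bar>(S - real (m N) * \<Phi> x) / real (m N)\<bar>"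
        by (simp add: abs_divide)
      also have "(S - real (m N) * \<Phi> x) / real (m N) = S / real (m N) - \<Phi> x"
        using m(1)[of N] by (simp add: diff_divide_distrib)
      finally show ?case by (simp add: S_def x_def)
    qed
    show "(\<lambda>N. C * b / real (m N)) \<longlonglongrightarrow> 0"
      using m(2) by (intro real_tendsto_divide_at_top[OF tendsto_const] filterlim_compose[OF filterlim_real_sequentially])
  qed
  ultimately show ?thesis
    using tendsto_add by (fastforce simp: \<Phi>_def)
qed

section \<open>Asymptotics\<close>

theorem theorem6:
  fixes M :: "nat \<Rightarrow> 'a measure"
    and T :: "nat \<Rightarrow> 'a \<Rightarrow> nat"
    and m k :: "nat \<Rightarrow> nat"
    and \<theta> l :: real
  assumes \<theta>: "0 < \<theta>" "\<theta> \<le> 1"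
    and k: "\<And>N. 0 < k N" "\<And>N. k N \<le> m N"
    and M: "\<And>N. prob_space (M N)"
    and T: "\<And>N. distributed (M N) (count_space UNIV) (T N)
                   (\<lambda>t. ennreal (neg_occ (m N) (k N) \<theta> t))"
    and m_lim: "filterlim m at_top sequentially"
    and k_lim: "filterlim k at_top sequentially"
    and km_lim: "(\<lambda>N. real (k N) / real (m N)) \<longlonglongrightarrow> l"
    and l: "l < 1"
  shows "(\<lambda>N. prob_space.expectation (M N) (\<lambda>\<omega>. real (T N \<omega>)))
           \<sim>[sequentially] (\<lambda>N. asymp_mean (m N) (k N) \<theta>) \<and>
         (\<lambda>N. prob_space.variance (M N) (\<lambda>\<omega>. real (T N \<omega>)))
           \<sim>[sequentially] (\<lambda>N. asymp_variance (m N) (k N) \<theta>) \<and>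
         (\<forall>r\<ge>3. \<exists>f :: real \<Rightarrow> real \<Rightarrow> real.
           (\<forall>(m'::nat) l' \<theta>'. 0 \<le> l' \<and> l' < 1 \<and> 0 < \<theta>' \<and> \<theta>' \<le> 1 \<longrightarrow>
              asymp_cumulant r m' l' \<theta>' = real m' * f l' \<theta>') \<and>
           (\<lambda>N. cumulant r (M N) (\<lambda>\<omega>. real (T N \<omega>)) / real (m N)) \<longlonglongrightarrow> f l \<theta>) \<and>
         (\<forall>r\<ge>3.
           (\<lambda>N. cumulant r (M N) (\<lambda>\<omega>. real (T N \<omega>) / real (m N)))
             \<in> O(\<lambda>N. 1 / real (m N)) \<and>
           (\<lambda>N. cumulant r (M N) (\<lambda>\<omega>. real (T N \<omega>) / real (m N))) \<longlonglongrightarrow> 0)"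
proof -
  define g where "g r x = geom_cgf_deriv r (\<theta> * (1 - x)) 0" for r x
  define S where "S r N = (\<Sum>i<k N. g r (real i / real (m N)))" for r N
  \<comment> \<open>A point strictly between \<open>l\<close> and 1: eventually \<open>k / m\<close>
    stays below it, and \<open>g r\<close> is regular on \<open>{0..b}\<close>, away from the
    singularity at 1.\<close>
  define b where "b = (l + 1) / 2"
  have b: "l < b" "b < 1" using l by (auto simp: b_def)
  have l0: "0 \<le> l" using km_lim by (rule LIMSEQ_le_const) auto
  have m: "0 < m N" for N using k[of N] by simp
  have kb: "eventually (\<lambda>N. real (k N) / real (m N) \<le> b) sequentially"
    using order_tendstoD(2)[OF km_lim b(1)] by eventually_elim simp
  have T_neg_occ: "neg_occ_distributed (M N) (T N) (m N) (k N) \<theta>" for N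
    using \<theta> k M T by (simp add: neg_occ_distributed_def neg_occ_distributed_axioms_def)
  have cumulant_T: "cumulant r (M N) (\<lambda>\<omega>. real (T N \<omega>) / c) = S r N / c ^ r" if "0 < c" for r N c
    using neg_occ_distributed.cumulant_scaled[OF T_neg_occ that]
    by (simp add: S_def g_def occ_prob_def)
  have cumulant_T1: "cumulant r (M N) (\<lambda>\<omega>. real (T N \<omega>)) = S r N" for r N
    using cumulant_T[of 1] by simp
  have limit: "(\<lambda>N. S r N / real (m N)) \<longlonglongrightarrow> limit_cumulant r l \<theta>" if r: "0 < r" for r
  proof -
    obtain C where "0 \<le> C" "\<And>x y. x \<in> {0..b} \<Longrightarrow> y \<in> {0..b} \<Longrightarrow> \<bar>g r x - g r y\<bar> \<le> C * \<bar>x - y\<bar>"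
      using geom_cumulant_lipschitz[OF \<theta>(1) b(2) r, folded g_def] by blast
    from riemann_sum_tendsto[OF this(2,1) m m_lim km_lim b(1)] show ?thesis
      unfolding S_def limit_cumulant_def g_def .
  qed
  have equiv: "S r \<sim>[sequentially] (\<lambda>N. real (m N) * (\<Phi> (real (k N) / real (m N)) - \<Phi> 0))"
    if r: "0 < r" and deriv: "\<And>x. x \<in> {0..b} \<Longrightarrow> (\<Phi> has_real_derivative g r x) (at x)"
      and lower: "\<And>x. x \<in> {0..b} \<Longrightarrow> x \<le> g r x" for r \<Phi>
  proof -
    obtain C where "0 \<le> C" "\<And>x y. x \<in> {0..b} \<Longrightarrow> y \<in> {0..b} \<Longrightarrow> \<bar>g r x - g r y\<bar> \<le> C * \<bar>x - y\<bar>"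
      using geom_cumulant_lipschitz[OF \<theta>(1) b(2) r, folded g_def] by blast
    from riemann_sum_asymp_equiv[OF has_field_derivative_at_within[OF deriv] this(2,1) lower k k_lim kb]
    show ?thesis unfolding S_def .
  qed
  \<comment> \<open>Since \<open>(1 + x) * (1 - x) \<le> 1\<close>, the value
    \<open>w = 1 / (\<theta> * (1 - x))\<close> is at least \<open>1 + x\<close>. This gives the
    lower bound \<open>x\<close> for both the geometric mean \<open>w - 1\<close> and the variance
    \<open>w * (w - 1)\<close>.\<close>
  have w: "1 + x \<le> 1 / (\<theta> * (1 - x))" if "x \<in> {0..b}" for x
  proof -
    have "(1 + x) * (\<theta> * (1 - x)) = \<theta> * (1 - x\<^sup>2)"
      by (simp add: algebra_simps power2_eq_square)
    also have "\<dots> \<le> 1 * 1"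
      using that b \<theta> by (intro mult_mono) (auto simp: power_le_one)
    finally show ?thesis
      using that b \<theta> by (simp add: pos_le_divide_eq)
  qed

  \<comment> \<open>Asymptotic mean and variance\<close>
  have mean: "(\<lambda>N. prob_space.expectation (M N) (\<lambda>\<omega>. real (T N \<omega>)))
      \<sim>[sequentially] (\<lambda>N. asymp_mean (m N) (k N) \<theta>)"
  proof -
    \<comment> \<open>An antiderivative of the geometric mean
      \<open>1 / (\<theta> * (1 - x)) - 1\<close>.\<close>
    define \<Phi> where "\<Phi> x = - x - ln (1 - x) / \<theta>" for x
    have "S 1 \<sim>[sequentially] (\<lambda>N. real (m N) * (\<Phi> (real (k N) / real (m N)) - \<Phi> 0))"
    proof (rule equiv)
      fix x assume x: "x \<in> {0..b}"
      show "(\<Phi> has_real_derivative g 1 x) (at x)"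
        unfolding \<Phi>_def using x b \<theta>
        by (auto intro!: derivative_eq_intros simp: g_def geom_cgf_deriv_at_0)
      show "x \<le> g 1 x" using w[OF x] by (simp add: g_def geom_cgf_deriv_at_0)
    qed simp
    moreover have "S 1 = (\<lambda>N. prob_space.expectation (M N) (\<lambda>\<omega>. real (T N \<omega>)))"
      using neg_occ_distributed.expectation_T[OF T_neg_occ]
      by (simp add: S_def g_def occ_prob_def fun_eq_iff)
    moreover have "real (m N) * (\<Phi> (real (k N) / real (m N)) - \<Phi> 0) = asymp_mean (m N) (k N) \<theta>" for N
      using m[of N] by (simp add: \<Phi>_def asymp_mean_def diff_divide_distrib right_diff_distrib)
    ultimately show ?thesis by simp
  qed
  have variance: "(\<lambda>N. prob_space.variance (M N) (\<lambda>\<omega>. real (T N \<omega>)))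
      \<sim>[sequentially] (\<lambda>N. asymp_variance (m N) (k N) \<theta>)"
  proof -
    \<comment> \<open>An antiderivative of \<open>w\<^sup>2 - w\<close>; taking
      \<open>x / (1 - x)\<close> instead of \<open>1 / (1 - x)\<close> makes it vanish at 0.\<close>
    define \<Phi> where "\<Phi> x = x / (1 - x) / \<theta>\<^sup>2 + ln (1 - x) / \<theta>" for x
    have g2: "g 2 x = 1 / (\<theta> * (1 - x)) * (1 / (\<theta> * (1 - x)) - 1)" for x
      by (simp add: g_def geom_cgf_deriv_at_0 numeral_2_eq_2 pderiv_pCons algebra_simps)
    have "S 2 \<sim>[sequentially] (\<lambda>N. real (m N) * (\<Phi> (real (k N) / real (m N)) - \<Phi> 0))"
    proof (rule equiv)
      fix x assume x: "x \<in> {0..b}"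
      have "((\<lambda>x. x / (1 - x)) has_real_derivative 1 / (1 - x)\<^sup>2) (at x)"
        using x b by (auto intro!: derivative_eq_intros simp: power2_eq_square)
      moreover have "((\<lambda>x. ln (1 - x)) has_real_derivative - 1 / (1 - x)) (at x)"
        using x b by (auto intro!: derivative_eq_intros)
      ultimately have deriv: "(\<Phi> has_real_derivative 1 / (1 - x)\<^sup>2 / \<theta>\<^sup>2 + - 1 / (1 - x) / \<theta>) (at x)"
        unfolding \<Phi>_def by (intro DERIV_add DERIV_cdivide)
      have "1 / y\<^sup>2 / \<theta>\<^sup>2 + - 1 / y / \<theta> = 1 / (\<theta> * y) * (1 / (\<theta> * y) - 1)" for y
        by (simp add: algebra_simps power2_eq_square)
      from deriv [unfolded this] show "(\<Phi> has_real_derivative g 2 x) (at x)"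
        unfolding g2 .
      have "1 * x \<le> g 2 x"
        unfolding g2
      proof (rule mult_mono)
        show "1 \<le> 1 / (\<theta> * (1 - x))" "x \<le> 1 / (\<theta> * (1 - x)) - 1"
          using w[OF x] x unfolding atLeastAtMost_iff by linarith+
      qed (use x b \<theta> in auto)
      then show "x \<le> g 2 x" by simp
    qed simp
    moreover have "S 2 = (\<lambda>N. prob_space.variance (M N) (\<lambda>\<omega>. real (T N \<omega>)))"
      using neg_occ_distributed.variance_T[OF T_neg_occ]
      by (simp add: S_def g_def occ_prob_def fun_eq_iff)
    moreover have "real (m N) * (\<Phi> (real (k N) / real (m N)) - \<Phi> 0) = asymp_variance (m N) (k N) \<theta>" for N
    proof -
      define x where "x = real (k N) / real (m N)"
      have x: "(real (m N) - real (k N)) / real (m N) = 1 - x"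
        using m[of N] by (simp add: x_def diff_divide_distrib)
      have "x / (1 - x) = real (k N) / (real (m N) - real (k N))"
        unfolding x [symmetric] using m[of N] by (simp add: x_def)
      then show ?thesis
        by (simp add: \<Phi>_def asymp_variance_def x flip: x_def) (simp add: algebra_simps)
    qed
    ultimately show ?thesis by simp
  qed

  \<comment> \<open>Higher cumulants of the scaled variable\<close>
  have scaled: "(\<lambda>N. cumulant r (M N) (\<lambda>\<omega>. real (T N \<omega>) / real (m N))) \<in> O(\<lambda>N. 1 / real (m N))"
    if "3 \<le> r" for r
  proof -
    \<comment> \<open>The scaled cumulant is \<open>S r N / m\<close> times
      \<open>(1 / m) ^ (r - 1)\<close>: the first factor converges and so is bounded, the second is
      at most \<open>1 / m\<close>.\<close>
    have "(\<lambda>N. S r N / real (m N)) \<in> O(\<lambda>_. 1)"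
      using that limit[of r] by (intro bigoI_tendsto) auto
    moreover have "(\<lambda>N. (1 / real (m N)) ^ (r - 1)) \<in> O(\<lambda>N. 1 / real (m N))"
    proof (rule landau_o.big_mono, intro always_eventually allI)
      fix N
      have "(1 / real (m N)) ^ (r - 1) \<le> (1 / real (m N)) ^ 1"
        using m[of N] that by (intro power_decreasing) auto
      then show "norm ((1 / real (m N)) ^ (r - 1)) \<le> norm (1 / real (m N))" by simp
    qed
    ultimately have "(\<lambda>N. S r N / real (m N) * (1 / real (m N)) ^ (r - 1)) \<in> O(\<lambda>N. 1 * (1 / real (m N)))"
      by (rule landau_o.big.mult)
    moreover have "S r N / real (m N) * (1 / real (m N)) ^ (r - 1) =
        cumulant r (M N) (\<lambda>\<omega>. real (T N \<omega>) / real (m N))" for N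
      using m[of N] that cumulant_T[of "real (m N)" r N] power_Suc[of "real (m N)" "r - 1"]
      by (simp add: power_one_over)
    ultimately show ?thesis by simp
  qed
  have inverse_m: "(\<lambda>N. 1 / real (m N)) \<longlonglongrightarrow> 0"
    using m_lim by (intro real_tendsto_divide_at_top[OF tendsto_const] filterlim_compose[OF filterlim_real_sequentially])
  have vanish: "(\<lambda>N. cumulant r (M N) (\<lambda>\<omega>. real (T N \<omega>) / real (m N))) \<longlonglongrightarrow> 0"
    if "3 \<le> r" for r
  proof -
    have "(\<lambda>N. 1 / real (m N)) \<in> o(\<lambda>_. 1)"
      using inverse_m by (intro smalloI_tendsto) auto
    with scaled[OF that] show ?thesis
      using smalloD_tendsto landau_o.big_small_trans by fastforce
  qed
  show ?thesis
  proof (intro conjI allI impI mean variance scaled vanish)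
    fix r :: nat assume r: "3 \<le> r"
    show "\<exists>f :: real \<Rightarrow> real \<Rightarrow> real.
        (\<forall>(m'::nat) l' \<theta>'. 0 \<le> l' \<and> l' < 1 \<and> 0 < \<theta>' \<and> \<theta>' \<le> 1 \<longrightarrow>
           asymp_cumulant r m' l' \<theta>' = real m' * f l' \<theta>') \<and>
        (\<lambda>N. cumulant r (M N) (\<lambda>\<omega>. real (T N \<omega>)) / real (m N)) \<longlonglongrightarrow> f l \<theta>"
      using r limit[of r] by (intro exI[of _ "limit_cumulant r"]) (auto simp: asymp_cumulant_eq cumulant_T1)
  qed
qed

end
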